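(* Let $p$ be a prime, $K$ a field of characteristic $p$, $R=K[x_1,\ldots,x_n]$ with $n\ge1$, and let $I\subseteq R$ be a squarefree monomial ideal with minimal primary decomposition $I=I_1\cap\cdots\cap I_t$ (each $I_k$ an ideal generated by variables) such that $I_1+\cdots+I_t=(x_1,\ldots,x_n)$. Let the ideals $J_e$ and $L_e$ be as defined in the context. For every integer $e\geq 1$, if $J_e\neq 0$, then there is at least one minimal monomial generator of $J_e$ which does not belong to $L_e$.
   Context: For an ideal $J\subseteq R$ and $a\geq 0$, $J^{[p^a]}$ is the ideal generated by the $p^a$-th powers of the elements of $J$ (equivalently, of a generating set of $J$). $(\mathfrak a:\mathfrak b)=\{f\in R: f\mathfrak b\subseteq\mathfrak a\}$. For $a\ge 0$, $J_a$ is the monomial ideal generated by those minimal monomial generators of $(I^{[p^a]}:I)$ that do not lie in $I^{[p^a]}+\big((x_1\cdots x_n)^{p^a-1}\big)$ ($J_a=0$ if there are none). $L_1:=0$ and, for $e\geq2$, $$L_e:=\sum_{\substack{1\leq b_1,\ldots,b_s\leq e-1\\ b_1+\cdots+b_s=e}}\Big(I^{[p^{b_1}]}:I\Big)\cdot\prod_{k=2}^{s}\Big(I^{[p^{b_1+\cdots+b_k}]}:I^{[p^{b_1+\cdots+b_{k-1}}]}\Big),$$ the sum ranging over all finite sequences $(b_1,\ldots,b_s)$ (of any length $s$) of integers satisfying the indicated conditions. *)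

theory Defs
  imports
    "HOL-Computational_Algebra.Computational_Algebra"
    "HOL-Library.Poly_Mapping"
    "HOL-Library.Set_Algebras"
begin

section \<open>Ideals of a commutative ring\<close>

text \<open>
  A ring is a module over itself by multiplication; its submodules are the ideals and spans are
  the generated ideals.  The sum of two ideals is the elementwise sum \<open>A + B\<close> of sets
  from \<open>Set_Algebras\<close>; the induced big operator has \<open>{0}\<close> as its empty sum.  The product of sets
  from that theory is not the product of ideals, which is \<open>ideal_prod\<close> below.
\<close>

global_interpretation ideal: module "(*) :: 'a::comm_ring_1 \<Rightarrow> 'a \<Rightarrow> 'a"
  defines is_ideal = ideal.subspace
    and ideal_gen = ideal.span
  by standard (simp_all add: algebra_simps)

definition ideal_prod :: "'a::comm_ring_1 set \<Rightarrow> 'a set \<Rightarrow> 'a set" where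
  "ideal_prod A B = ideal_gen {a * b | a b. a \<in> A \<and> b \<in> B}"

definition ideal_prod_list :: "'a::comm_ring_1 set list \<Rightarrow> 'a set" where
  "ideal_prod_list As = foldr ideal_prod As UNIV"

definition ideal_colon :: "'a::comm_ring_1 set \<Rightarrow> 'a set \<Rightarrow> 'a set" where
  "ideal_colon A B = {f. \<forall>b\<in>B. f * b \<in> A}"

text \<open>\<open>frob_power p J a\<close> is $J^{[p^a]}$.\<close>

definition frob_power :: "nat \<Rightarrow> 'a::comm_ring_1 set \<Rightarrow> nat \<Rightarrow> 'a set" where
  "frob_power p J a = ideal_gen ((\<lambda>f. f ^ (p ^ a)) ` J)"

definition ideal_radical :: "'a::comm_ring_1 set \<Rightarrow> 'a set" where
  "ideal_radical A = {f. \<exists>m. f ^ m \<in> A}"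

definition primary_ideal :: "'a::comm_ring_1 set \<Rightarrow> bool" where
  "primary_ideal Q \<longleftrightarrow>
     is_ideal Q \<and> Q \<noteq> UNIV \<and> (\<forall>f g. f * g \<in> Q \<longrightarrow> f \<in> Q \<or> g \<in> ideal_radical Q)"

definition minimal_primary_decomposition ::
    "'a::comm_ring_1 set \<Rightarrow> nat \<Rightarrow> (nat \<Rightarrow> 'a set) \<Rightarrow> bool" where
  "minimal_primary_decomposition A t Q \<longleftrightarrow>
     A = (\<Inter>k\<in>{1..t}. Q k) \<and>
     (\<forall>k\<in>{1..t}. primary_ideal (Q k)) \<and>
     inj_on (\<lambda>k. ideal_radical (Q k)) {1..t} \<and>
     (\<forall>k\<in>{1..t}. \<not> (\<Inter>j\<in>{1..t} - {k}. Q j) \<subseteq> Q k)"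


section \<open>Monomial ideals of a polynomial ring\<close>

text \<open>
  Polynomials in variables indexed by the finite type \<open>'n\<close>: finitely supported functions from
  exponent vectors to coefficients, multiplied by convolution.
\<close>

type_synonym ('n, 'k) mpoly = "('n \<Rightarrow>\<^sub>0 nat) \<Rightarrow>\<^sub>0 'k"

definition monom_of :: "('n \<Rightarrow>\<^sub>0 nat) \<Rightarrow> ('n, 'k::comm_ring_1) mpoly" where
  "monom_of v = Poly_Mapping.single v 1"

definition Var :: "'n \<Rightarrow> ('n, 'k::comm_ring_1) mpoly" where
  "Var i = monom_of (Poly_Mapping.single i 1)"

definition squarefree_monomial_ideal :: "('n, 'k::comm_ring_1) mpoly set \<Rightarrow> bool" where
  "squarefree_monomial_ideal A \<longleftrightarrow>
     (\<exists>E. (\<forall>v\<in>E. \<forall>i. Poly_Mapping.lookup v i \<le> 1) \<and> A = ideal_gen (monom_of ` E))"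

definition generated_by_variables :: "('n, 'k::comm_ring_1) mpoly set \<Rightarrow> bool" where
  "generated_by_variables A \<longleftrightarrow> (\<exists>S. A = ideal_gen (Var ` S))"

definition minimal_monomial_generating_set ::
    "('n, 'k::comm_ring_1) mpoly set \<Rightarrow> ('n, 'k) mpoly set \<Rightarrow> bool" where
  "minimal_monomial_generating_set A G \<longleftrightarrow>
     G \<subseteq> range monom_of \<and> ideal_gen G = A \<and> (\<forall>H. H \<subset> G \<longrightarrow> ideal_gen H \<noteq> A)"

text \<open>A monomial ideal has exactly one minimal monomial generating set, so the union is that set.\<close>

definition minimal_monomial_generators ::
    "('n, 'k::comm_ring_1) mpoly set \<Rightarrow> ('n, 'k) mpoly set" where
  "minimal_monomial_generators A = \<Union> {G. minimal_monomial_generating_set A G}"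


section \<open>The ideals $J_a$ and $L_e$\<close>

definition J_ideal ::
    "nat \<Rightarrow> ('n::finite, 'k::comm_ring_1) mpoly set \<Rightarrow> nat \<Rightarrow> ('n, 'k) mpoly set" where
  "J_ideal p I a = ideal_gen
     {m \<in> minimal_monomial_generators (ideal_colon (frob_power p I a) I).
        m \<notin> frob_power p I a + ideal_gen {(\<Prod>i\<in>UNIV. Var i) ^ (p ^ a - 1)}}"

definition L_indices :: "nat \<Rightarrow> nat list set" where
  "L_indices e = {bs. bs \<noteq> [] \<and> (\<forall>b\<in>set bs. 1 \<le> b \<and> b \<le> e - 1) \<and> sum_list bs = e}"

lemma finite_L_indices: "finite (L_indices e)"
proof (rule finite_subset)
  have "length bs \<le> sum_list bs" if "\<forall>b\<in>set bs. 1 \<le> b" for bs :: "nat list"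
    using that by (induction bs) auto
  then show "L_indices e \<subseteq> {bs. set bs \<subseteq> {..e} \<and> length bs \<le> e}"
    by (fastforce simp: L_indices_def)
qed (simp add: finite_lists_length_le)

text \<open>Lists are indexed from 0: $b_1$ is \<open>hd bs\<close>, and $b_1 + \dots + b_k$ is \<open>sum_list (take k bs)\<close>.\<close>

definition L_term ::
    "nat \<Rightarrow> ('n, 'k::comm_ring_1) mpoly set \<Rightarrow> nat list \<Rightarrow> ('n, 'k) mpoly set" where
  "L_term p I bs =
     ideal_prod (ideal_colon (frob_power p I (hd bs)) I)
       (ideal_prod_list
         (map (\<lambda>k. ideal_colon (frob_power p I (sum_list (take k bs)))
                               (frob_power p I (sum_list (take (k - 1) bs))))
              [2..<length bs + 1]))"

text \<open>\<open>L_indices 1\<close> is empty, so the formula also gives $L_1 = 0$.\<close>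

definition L_ideal ::
    "nat \<Rightarrow> ('n, 'k::comm_ring_1) mpoly set \<Rightarrow> nat \<Rightarrow> ('n, 'k) mpoly set" where
  "L_ideal p I e = (\<Sum>bs\<in>L_indices e. L_term p I bs)"

lemma L_ideal_1: "L_ideal p I 1 = {0}"
proof -
  have "L_indices 1 = {}"
    unfolding L_indices_def by (auto simp: neq_Nil_conv)
  then show ?thesis by (simp add: L_ideal_def)
qed

end

theory Submission
  imports Defs
begin

text \<open>
  Write $I_X = (x_i : i \in X)$ for $X$ in an antichain of sets of variables covering all
  variables, $I = \bigcap_X I_X$.  The colon ideals telescope, so $L_e$ is contained in the sum over
  $1 \le a < e$ of the products $(I^{[p^a]} : I) (I^{[p^e]} : I^{[p^a]})$.  A monomial $x^v$ lies in
  $(I^{[q]} : I^{[r]})$ iff for every $X$ either some $i \in X$ has $v_i \ge q$ or all $i \in X$ have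
  $v_i \ge q - r$.  Put $q = p^e$.  A minimal generator $x^v$ of $(I^{[q]} : I)$ has exponents in
  $\{0, q - 1, q\}$, and if it is not divisible by $(x_1 \cdots x_n)^{q-1}$, minimality gives an $X$ with
  exactly one exponent $q$ and at least one exponent $0$.  If $x^v$ were divisible by a product
  $x^w x^{w'}$ as above, then over $X$ the exponent $q$ would be used up by $w'$, while $w$ needs an
  exponent $\ge p^a$ at some $j \in X$ with $v_j = q - 1$; an $X'$ containing $j$ and having no exponent
  $q$ forces $w'_j \ge q - p^a$, a contradiction.  So no minimal generator of $J_e$ is in $L_e$.
\<close>

section \<open>Monomial ideals as sets of exponent vectors\<close>

text \<open>The symbol \<open>\<le>\<close> on polynomial mappings is lexicographic, so divisibility needs its own relation.\<close>

abbreviation exp_le :: "('n \<Rightarrow>\<^sub>0 nat) \<Rightarrow> ('n \<Rightarrow>\<^sub>0 nat) \<Rightarrow> bool" (infix "\<preceq>" 50) where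
  "u \<preceq> v \<equiv> \<forall>i. Poly_Mapping.lookup u i \<le> Poly_Mapping.lookup v i"

definition up_closure :: "('n \<Rightarrow>\<^sub>0 nat) set \<Rightarrow> ('n \<Rightarrow>\<^sub>0 nat) set" where
  "up_closure E = {v. \<exists>u\<in>E. u \<preceq> v}"

text \<open>For upward closed \<open>A\<close> this is the monomial ideal with exponent set
  \<open>A\<close>. For other \<open>A\<close> it need not be an ideal, hence the hypothesis
  \<open>up_closure A = A\<close> below.\<close>

definition supp_ideal :: "('n \<Rightarrow>\<^sub>0 nat) set \<Rightarrow> ('n, 'k::comm_ring_1) mpoly set" where
  "supp_ideal A = {f. Poly_Mapping.keys f \<subseteq> A}"

lemma exp_le_obtain_add:
  assumes "u \<preceq> v"
  obtains w where "v = u + w"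
proof
  show "v = u + (v - u)"
    using assms by (intro poly_mapping_eqI) (simp add: lookup_add lookup_minus)
qed

lemma subset_up_closure: "E \<subseteq> up_closure E"
  by (auto simp: up_closure_def)

lemma up_closure_eqI:
  assumes "\<And>u v. u \<in> A \<Longrightarrow> u \<preceq> v \<Longrightarrow> v \<in> A"
  shows "up_closure A = A"
  using assms by (auto simp: up_closure_def)

lemma up_closure_add:
  assumes "v \<in> up_closure E"
  shows "w + v \<in> up_closure E"
  using assms unfolding up_closure_def
  by (auto simp: lookup_add intro: trans_le_add2)

lemma is_ideal_supp_ideal:
  assumes "up_closure A = A"
  shows "is_ideal (supp_ideal A)"
proof (rule ideal.subspaceI)
  show "0 \<in> supp_ideal A"
    by (simp add: supp_ideal_def)
  show "x + y \<in> supp_ideal A" if "x \<in> supp_ideal A" "y \<in> supp_ideal A"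
    for x y :: "('a, 'b) mpoly"
    using that Poly_Mapping.keys_add[of x y] unfolding supp_ideal_def by blast
  show "c * x \<in> supp_ideal A" if "x \<in> supp_ideal A" for c x :: "('a, 'b) mpoly"
    using that keys_mult[of c x] up_closure_add[of _ A] assms unfolding supp_ideal_def by blast
qed

lemma monom_of_in_supp_ideal [simp]:
  "(monom_of v :: ('n, 'k::comm_ring_1) mpoly) \<in> supp_ideal A \<longleftrightarrow> v \<in> A"
  by (simp add: supp_ideal_def monom_of_def)

lemma sum_keys_single: "(\<Sum>v\<in>Poly_Mapping.keys f. Poly_Mapping.single v (Poly_Mapping.lookup f v)) = f"
proof (rule poly_mapping_eqI)
  fix v
  show "Poly_Mapping.lookup (\<Sum>v\<in>Poly_Mapping.keys f.
          Poly_Mapping.single v (Poly_Mapping.lookup f v)) v = Poly_Mapping.lookup f v"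
    by (simp add: lookup_sum lookup_single when_def in_keys_iff)
qed

lemma supp_ideal_subset:
  assumes "is_ideal T" "\<And>v. v \<in> A \<Longrightarrow> monom_of v \<in> T"
  shows "supp_ideal A \<subseteq> T"
proof
  fix f :: "('a, 'b) mpoly"
  assume f: "f \<in> supp_ideal A"
  have "Poly_Mapping.single v (Poly_Mapping.lookup f v) \<in> T" if "v \<in> Poly_Mapping.keys f" for v
  proof -
    have "Poly_Mapping.single 0 (Poly_Mapping.lookup f v) * monom_of v \<in> T"
      using that f assms by (intro ideal.subspace_scale) (auto simp: supp_ideal_def)
    then show ?thesis
      by (simp add: monom_of_def mult_single)
  qed
  then have "(\<Sum>v\<in>Poly_Mapping.keys f. Poly_Mapping.single v (Poly_Mapping.lookup f v)) \<in> T"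
    by (intro ideal.subspace_sum assms)
  then show "f \<in> T"
    by (simp add: sum_keys_single)
qed

text \<open>Each monomial above a member of \<open>E\<close> is a multiple of a generator, and
  upward closed exponent sets give ideals. Membership in a monomial ideal thus becomes a question
  about exponents.\<close>

lemma ideal_gen_monom_of:
  "ideal_gen (monom_of ` E) = (supp_ideal (up_closure E) :: ('n, 'k::comm_ring_1) mpoly set)"
proof
  have "up_closure (up_closure E) = up_closure E"
    unfolding up_closure_def by (auto intro: order_trans)
  then show "ideal_gen (monom_of ` E) \<subseteq> (supp_ideal (up_closure E) :: ('n, 'k) mpoly set)"
    by (intro ideal.span_minimal is_ideal_supp_ideal) (auto simp: up_closure_def)
  show "(supp_ideal (up_closure E) :: ('n, 'k) mpoly set) \<subseteq> ideal_gen (monom_of ` E)"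
  proof (rule supp_ideal_subset)
    fix v assume "v \<in> up_closure E"
    then obtain u where u: "u \<in> E" "u \<preceq> v"
      by (auto simp: up_closure_def)
    then obtain w where "v = u + w"
      using exp_le_obtain_add by metis
    then have "(monom_of v :: ('n, 'k) mpoly) = monom_of w * monom_of u"
      by (simp add: monom_of_def mult_single add.commute)
    then show "(monom_of v :: ('n, 'k) mpoly) \<in> ideal_gen (monom_of ` E)"
      using u by (simp add: ideal.span_scale ideal.span_base)
  qed (rule ideal.subspace_span)
qed

lemma ideal_colon_supp_ideal:
  assumes "up_closure A = A"
  shows "ideal_colon (supp_ideal A) (supp_ideal B) =
    (supp_ideal {v. \<forall>u\<in>B. v + u \<in> A} :: ('n, 'k::comm_ring_1) mpoly set)"
proof (intro equalityI subsetI)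
  fix f :: "('n, 'k) mpoly"
  assume f: "f \<in> ideal_colon (supp_ideal A) (supp_ideal B)"
  have "v + u \<in> A" if "v \<in> Poly_Mapping.keys f" "u \<in> B" for u v
  proof -
    \<comment> \<open>Adding \<open>u\<close> is injective on exponents, so nothing cancels and the
      coefficient of \<open>v\<close> survives the shift.\<close>
    have "Poly_Mapping.lookup (f * monom_of u) (v + u) = Poly_Mapping.lookup f v"
    proof -
      have "f * monom_of u =
        (\<Sum>w\<in>Poly_Mapping.keys f. Poly_Mapping.single (w + u) (Poly_Mapping.lookup f w))"
        by (subst (1) sum_keys_single[symmetric])
           (simp add: sum_distrib_right monom_of_def mult_single)
      then show ?thesis
        using that by (simp add: lookup_sum lookup_single when_def)
    qed
    moreover have "f * monom_of u \<in> supp_ideal A"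
      using f that by (simp add: ideal_colon_def)
    ultimately show ?thesis
      using that by (auto simp: supp_ideal_def in_keys_iff)
  qed
  then show "f \<in> supp_ideal {v. \<forall>u\<in>B. v + u \<in> A}"
    by (auto simp: supp_ideal_def)
next
  fix f :: "('n, 'k) mpoly"
  assume f: "f \<in> supp_ideal {v. \<forall>u\<in>B. v + u \<in> A}"
  have "f * b \<in> supp_ideal A" if "b \<in> supp_ideal B" for b
    using that f keys_mult[of f b] unfolding supp_ideal_def by blast
  then show "f \<in> ideal_colon (supp_ideal A) (supp_ideal B)"
    by (simp add: ideal_colon_def)
qed

lemma CHAR_poly_mapping [simp]: "CHAR('a::comm_monoid_add \<Rightarrow>\<^sub>0 'k::comm_ring_1) = CHAR('k)"
  by (rule CHAR_eqI) (auto simp: of_nat_eq_0_iff_char_dvd simp flip: single_of_nat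
      dest!: arg_cong[where f = "\<lambda>f. Poly_Mapping.lookup f 0"])

lemma monom_of_power:
  "Poly_Mapping.lookup w = (\<lambda>i. n * Poly_Mapping.lookup v i) \<Longrightarrow> monom_of v ^ n = monom_of w"
proof (induction n arbitrary: w)
  case 0
  then have "w = 0"
    by (intro poly_mapping_eqI) simp
  then show ?case
    by (simp add: monom_of_def)
next
  case (Suc n)
  have "v \<preceq> w"
    by (simp add: Suc.prems)
  then obtain w' where w': "w = v + w'"
    using exp_le_obtain_add by metis
  then have "Poly_Mapping.lookup w' = (\<lambda>i. n * Poly_Mapping.lookup v i)"
    using Suc.prems by (auto simp: lookup_add fun_eq_iff)
  then show ?case
    by (simp add: Suc.IH w') (simp add: monom_of_def mult_single)
qed

lemma single_power_coeff:
  "Poly_Mapping.single v c ^ n = Poly_Mapping.single 0 (c ^ n) * (monom_of v :: ('n, 'k::comm_ring_1) mpoly) ^ n"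
proof -
  have "Poly_Mapping.single 0 c ^ n = (Poly_Mapping.single 0 (c ^ n) :: ('n, 'k) mpoly)"
    by (induction n) (simp_all add: mult_single)
  moreover have "Poly_Mapping.single v c = Poly_Mapping.single 0 c * (monom_of v :: ('n, 'k) mpoly)"
    by (simp add: monom_of_def mult_single)
  ultimately show ?thesis
    by (simp add: power_mult_distrib)
qed

text \<open>In characteristic p the \<open>p^a\<close>-th power of a sum is the sum of the powers,
  so powers of polynomials reduce to powers of their terms. Together with \<open>upB\<close>, the
  hypotheses \<open>AB\<close> and \<open>BA\<close> say that \<open>B\<close> is the upward closure
  of the \<open>p^a\<close>-fold multiples of \<open>A\<close>.\<close>

lemma frob_power_supp_ideal:
  fixes A B :: "('n \<Rightarrow>\<^sub>0 nat) set"
  assumes "prime CHAR('k::comm_ring_1)"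
    and upB: "up_closure B = B"
    and AB: "\<And>u v. u \<in> A \<Longrightarrow> Poly_Mapping.lookup v = (\<lambda>i. CHAR('k) ^ a * Poly_Mapping.lookup u i) \<Longrightarrow> v \<in> B"
    and BA: "\<And>v. v \<in> B \<Longrightarrow> \<exists>u\<in>A. \<exists>w. w \<preceq> v \<and> Poly_Mapping.lookup w = (\<lambda>i. CHAR('k) ^ a * Poly_Mapping.lookup u i)"
  shows "frob_power CHAR('k) (supp_ideal A) a = (supp_ideal B :: ('n, 'k) mpoly set)"
proof
  let ?q = "CHAR('k) ^ a"
  have q: "?q = CHAR(('n, 'k) mpoly) ^ a"
    by simp
  have monom_B: "monom_of v ^ ?q \<in> (supp_ideal B :: ('n, 'k) mpoly set)" if "v \<in> A" for v
  proof -
    have "finite {i. ?q * Poly_Mapping.lookup v i \<noteq> 0}"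
      by (rule finite_subset[of _ "{i. Poly_Mapping.lookup v i \<noteq> 0}"]) auto
    then have *: "Poly_Mapping.lookup (Abs_poly_mapping (\<lambda>i. ?q * Poly_Mapping.lookup v i)) =
       (\<lambda>i. ?q * Poly_Mapping.lookup v i)"
      by simp
    show ?thesis
      unfolding monom_of_power[OF *] using AB[OF that *] by simp
  qed
  show "frob_power CHAR('k) (supp_ideal A) a \<subseteq> (supp_ideal B :: ('n, 'k) mpoly set)"
    unfolding frob_power_def
  proof (intro ideal.span_minimal is_ideal_supp_ideal upB image_subsetI)
    fix f :: "('n, 'k) mpoly"
    assume f: "f \<in> supp_ideal A"
    have "f ^ ?q = (\<Sum>v\<in>Poly_Mapping.keys f. Poly_Mapping.single v (Poly_Mapping.lookup f v)) ^ ?q"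
      by (simp add: sum_keys_single)
    also have "\<dots> = (\<Sum>v\<in>Poly_Mapping.keys f. Poly_Mapping.single v (Poly_Mapping.lookup f v) ^ ?q)"
      by (rule freshmans_dream_sum'[OF _ q]) (simp add: assms)
    also have "\<dots> \<in> supp_ideal B"
    proof (rule ideal.subspace_sum[OF is_ideal_supp_ideal[OF upB]])
      fix v assume "v \<in> Poly_Mapping.keys f"
      then have "v \<in> A"
        using f by (auto simp: supp_ideal_def)
      then show "Poly_Mapping.single v (Poly_Mapping.lookup f v) ^ ?q \<in> supp_ideal B"
        unfolding single_power_coeff
        by (intro ideal.subspace_scale is_ideal_supp_ideal upB monom_B)
    qed
    finally show "f ^ ?q \<in> supp_ideal B" .
  qed
  show "(supp_ideal B :: ('n, 'k) mpoly set) \<subseteq> frob_power CHAR('k) (supp_ideal A) a"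
  proof (rule supp_ideal_subset)
    show "is_ideal (frob_power CHAR('k) (supp_ideal A) a :: ('n, 'k) mpoly set)"
      unfolding frob_power_def by (rule ideal.subspace_span)
    fix v assume "v \<in> B"
    then obtain u w where u: "u \<in> A" and w: "w \<preceq> v"
      "Poly_Mapping.lookup w = (\<lambda>i. ?q * Poly_Mapping.lookup u i)"
      using BA by metis
    obtain x where x: "v = w + x"
      using exp_le_obtain_add w(1) by metis
    have "(monom_of v :: ('n, 'k) mpoly) = monom_of x * monom_of u ^ ?q"
      unfolding monom_of_power[OF w(2)] x by (simp add: monom_of_def mult_single add.commute)
    moreover have "(monom_of u :: ('n, 'k) mpoly) \<in> supp_ideal A"
      using u by simp
    ultimately show "(monom_of v :: ('n, 'k) mpoly) \<in> frob_power CHAR('k) (supp_ideal A) a"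
      unfolding frob_power_def by (simp add: ideal.span_scale ideal.span_base)
  qed
qed


section \<open>Minimal monomial generators\<close>

text \<open>A generator divisible by a different one could be dropped without changing the ideal, so
  irredundancy forces minimality for divisibility.\<close>

lemma minimal_monomial_generatorsE:
  assumes "m \<in> minimal_monomial_generators (supp_ideal A)"
  obtains v where "m = monom_of v" "v \<in> A" "\<And>u. u \<in> A \<Longrightarrow> u \<preceq> v \<Longrightarrow> u = v"
proof -
  obtain G where G: "minimal_monomial_generating_set (supp_ideal A) G" "m \<in> G"
    using assms by (auto simp: minimal_monomial_generators_def)
  then obtain v where v: "m = monom_of v"
    by (auto simp: minimal_monomial_generating_set_def)
  obtain E where E: "G = monom_of ` E"
    using G by (metis minimal_monomial_generating_set_def subset_imageE)
  have GA: "ideal_gen G = supp_ideal A"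
    using G by (simp add: minimal_monomial_generating_set_def)
  have in_A: "w \<in> A \<longleftrightarrow> (\<exists>u\<in>E. u \<preceq> w)" for w
  proof -
    have "w \<in> A \<longleftrightarrow> monom_of w \<in> ideal_gen G"
      by (simp add: GA)
    then show ?thesis
      unfolding E ideal_gen_monom_of by (simp add: up_closure_def)
  qed
  have E_min: "w = v" if w: "w \<in> E" "w \<preceq> v" for w
  proof (rule ccontr)
    assume "w \<noteq> v"
    let ?H = "G - {m}"
    \<comment> \<open>Injectivity of \<open>monom_of\<close> is read off from
      \<open>supp_ideal\<close> of a singleton.\<close>
    have "monom_of w \<noteq> m"
      using \<open>w \<noteq> v\<close> by (metis monom_of_in_supp_ideal singletonD singletonI v)
    then have wH: "monom_of w \<in> ?H"
      using w E by auto
    obtain x where "v = w + x"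
      using exp_le_obtain_add w(2) by metis
    then have "m = monom_of x * monom_of w"
      by (simp add: v monom_of_def mult_single add.commute)
    then have "m \<in> ideal_gen ?H"
      using wH by (metis ideal.span_base ideal.span_scale)
    then have "G \<subseteq> ideal_gen ?H"
      using ideal.span_superset[of ?H] by blast
    then have "ideal_gen G \<subseteq> ideal_gen ?H"
      by (intro ideal.span_minimal ideal.subspace_span)
    moreover have "ideal_gen ?H \<subseteq> ideal_gen G"
      by (rule ideal.span_mono) auto
    ultimately have "ideal_gen ?H = supp_ideal A"
      using GA by auto
    moreover have "?H \<subset> G"
      using G by auto
    ultimately show False
      using G by (auto simp: minimal_monomial_generating_set_def)
  qed
  show ?thesis
  proof
    show "v \<in> A"
      using G(2) ideal.span_base[of m G] unfolding GA v by simp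
    fix u assume u: "u \<in> A" "u \<preceq> v"
    then obtain w where w: "w \<in> E" "w \<preceq> u"
      using in_A by auto
    then have "w = v"
      using E_min u by (meson order_trans)
    then show "u = v"
      using w u by (intro poly_mapping_eqI) (meson antisym)
  qed fact
qed

text \<open>A monomial in \<open>ideal_gen H\<close> is divisible by a member of \<open>H\<close>,
  so removing any member of a divisibility antichain shrinks the ideal. This applies to the
  generators that define \<open>J_ideal\<close>.\<close>

lemma minimal_monomial_generatorsI:
  fixes G :: "('n, 'k::comm_ring_1) mpoly set"
  assumes "G = monom_of ` E" "\<And>u v. u \<in> E \<Longrightarrow> v \<in> E \<Longrightarrow> u \<preceq> v \<Longrightarrow> u = v"
  shows "G \<subseteq> minimal_monomial_generators (ideal_gen G)"
proof -
  have "ideal_gen H \<noteq> ideal_gen G" if H: "H \<subset> G" for H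
  proof
    assume eq: "ideal_gen H = ideal_gen G"
    obtain v where v: "v \<in> E" "monom_of v \<notin> H"
      using H assms(1) by auto
    obtain E' where E': "E' \<subseteq> E" "H = monom_of ` E'"
      using H assms(1) by (metis psubsetE subset_imageE)
    have "monom_of v \<in> ideal_gen H"
      unfolding eq using v assms(1) by (auto intro: ideal.span_base)
    then obtain u where "u \<in> E'" "u \<preceq> v"
      unfolding E' ideal_gen_monom_of by (auto simp: up_closure_def)
    then show False
      using v E' assms(2) by blast
  qed
  then have "minimal_monomial_generating_set (ideal_gen G) G"
    using assms(1) by (auto simp: minimal_monomial_generating_set_def)
  then show ?thesis
    by (auto simp: minimal_monomial_generators_def)
qed


section \<open>Colon ideals of Frobenius powers\<close>

text \<open>For a family \<open>\<S>\<close> of sets of variables, the exponents of the monomials in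
  $\bigcap_{X} (x_i^q : i \in X)$, and of those in the colon of this ideal by the one with $r$ in place of $q$.\<close>

definition power_exps :: "'n set set \<Rightarrow> nat \<Rightarrow> ('n \<Rightarrow>\<^sub>0 nat) set" where
  "power_exps \<S> q = {v. \<forall>X\<in>\<S>. \<exists>i\<in>X. q \<le> Poly_Mapping.lookup v i}"

definition colon_exps :: "'n set set \<Rightarrow> nat \<Rightarrow> nat \<Rightarrow> ('n \<Rightarrow>\<^sub>0 nat) set" where
  "colon_exps \<S> r q = {v. \<forall>X\<in>\<S>. (\<exists>i\<in>X. q \<le> Poly_Mapping.lookup v i) \<or>
     (\<forall>i\<in>X. q \<le> Poly_Mapping.lookup v i + r)}"

lemma up_closure_power_exps [simp]: "up_closure (power_exps \<S> q) = power_exps \<S> q"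
  by (rule up_closure_eqI) (unfold power_exps_def mem_Collect_eq, meson order_trans)

text \<open>If the condition fails at \<open>X\<close>, some \<open>u\<close> in
  \<open>power_exps \<S> r\<close> leaves \<open>v + u\<close> below \<open>q\<close> on all of
  \<open>X\<close>.\<close>

lemma colon_exps_iff:
  fixes v :: "'n::finite \<Rightarrow>\<^sub>0 nat"
  assumes antichain: "\<And>X Y. X \<in> \<S> \<Longrightarrow> Y \<in> \<S> \<Longrightarrow> X \<subseteq> Y \<Longrightarrow> X = Y"
  shows "v \<in> colon_exps \<S> r q \<longleftrightarrow> (\<forall>u\<in>power_exps \<S> r. v + u \<in> power_exps \<S> q)"
proof safe
  fix u assume v: "v \<in> colon_exps \<S> r q" and u: "u \<in> power_exps \<S> r"
  have "\<exists>i\<in>X. q \<le> Poly_Mapping.lookup v i + Poly_Mapping.lookup u i" if X: "X \<in> \<S>" for X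
  proof (cases "\<exists>i\<in>X. q \<le> Poly_Mapping.lookup v i")
    case True
    then show ?thesis
      by (auto intro: trans_le_add1)
  next
    case False
    then have "\<forall>i\<in>X. q \<le> Poly_Mapping.lookup v i + r"
      using v X unfolding colon_exps_def by blast
    moreover obtain i where "i \<in> X" "r \<le> Poly_Mapping.lookup u i"
      using u X unfolding power_exps_def by blast
    ultimately show ?thesis
      by (meson add_left_mono order_trans)
  qed
  then show "v + u \<in> power_exps \<S> q"
    by (simp add: power_exps_def lookup_add)
next
  assume v: "\<forall>u\<in>power_exps \<S> r. v + u \<in> power_exps \<S> q"
  show "v \<in> colon_exps \<S> r q"
  proof (rule ccontr)
    assume "v \<notin> colon_exps \<S> r q"
    then obtain X i where X: "X \<in> \<S>" "\<forall>i\<in>X. Poly_Mapping.lookup v i < q"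
      and i: "i \<in> X" "Poly_Mapping.lookup v i + r < q"
      by (auto simp: colon_exps_def not_le)
    \<comment> \<open>The vector \<open>u\<close> is \<open>r\<close> except on \<open>T\<close>,
      the part of \<open>X\<close> where adding \<open>r\<close> would reach \<open>q\<close>; there
      \<open>v\<close> alone is still below \<open>q\<close>.\<close>
    define T where "T = {i \<in> X. q \<le> Poly_Mapping.lookup v i + r}"
    define u where "u = Abs_poly_mapping (\<lambda>i. if i \<in> T then 0 else r)"
    have u: "Poly_Mapping.lookup u = (\<lambda>i. if i \<in> T then 0 else r)"
      unfolding u_def by simp
    have "\<not> Y \<subseteq> T" if "Y \<in> \<S>" for Y
    proof
      \<comment> \<open>The antichain condition turns this into \<open>Y = X\<close>, but
        \<open>i\<close> lies in \<open>X\<close> and not in \<open>T\<close>. Hence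
        \<open>u\<close> takes the value \<open>r\<close> on every member of the family.\<close>
      assume "Y \<subseteq> T"
      then have "Y = X"
        using antichain[OF that X(1)] by (auto simp: T_def)
      then show False
        using \<open>Y \<subseteq> T\<close> i by (auto simp: T_def)
    qed
    then have "u \<in> power_exps \<S> r"
      unfolding power_exps_def u mem_Collect_eq by (metis subsetI order_refl)
    then have "v + u \<in> power_exps \<S> q"
      using v by blast
    then obtain j where "j \<in> X" "q \<le> Poly_Mapping.lookup v j + Poly_Mapping.lookup u j"
      using X(1) by (auto simp: power_exps_def lookup_add)
    then show False
      using X(2) by (auto simp: u T_def split: if_splits)
  qed
qed

lemma ideal_colon_power_exps:
  fixes \<S> :: "'n::finite set set"
  assumes "\<And>X Y. X \<in> \<S> \<Longrightarrow> Y \<in> \<S> \<Longrightarrow> X \<subseteq> Y \<Longrightarrow> X = Y"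
  shows "ideal_colon (supp_ideal (power_exps \<S> q)) (supp_ideal (power_exps \<S> r)) =
    (supp_ideal (colon_exps \<S> r q) :: ('n, 'k::comm_ring_1) mpoly set)"
proof -
  have "colon_exps \<S> r q = {v. \<forall>u\<in>power_exps \<S> r. v + u \<in> power_exps \<S> q}"
    using colon_exps_iff[of \<S>] assms by auto
  then show ?thesis
    by (simp add: ideal_colon_supp_ideal)
qed

lemma frob_power_power_exps:
  fixes \<S> :: "'n::finite set set"
  assumes "prime CHAR('k::comm_ring_1)"
  shows "frob_power CHAR('k) (supp_ideal (power_exps \<S> 1)) a =
    (supp_ideal (power_exps \<S> (CHAR('k) ^ a)) :: ('n, 'k) mpoly set)"
proof (rule frob_power_supp_ideal[OF assms up_closure_power_exps])
  let ?q = "CHAR('k) ^ a"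
  show "v \<in> power_exps \<S> ?q"
    if u: "u \<in> power_exps \<S> 1" and v: "Poly_Mapping.lookup v = (\<lambda>i. ?q * Poly_Mapping.lookup u i)" for u v
    unfolding power_exps_def mem_Collect_eq
  proof
    fix X assume "X \<in> \<S>"
    then obtain i where "i \<in> X" "1 \<le> Poly_Mapping.lookup u i"
      using u unfolding power_exps_def by blast
    then show "\<exists>i\<in>X. ?q \<le> Poly_Mapping.lookup v i"
      unfolding v by (intro bexI[of _ i]) simp_all
  qed
  fix v assume v: "v \<in> power_exps \<S> ?q"
  \<comment> \<open>Thresholding \<open>v\<close> at \<open>?q\<close> gives a squarefree vector
    whose \<open>?q\<close>-fold multiple still lies below \<open>v\<close>.\<close>
  define f :: "'n \<Rightarrow> nat" where "f i = (if ?q \<le> Poly_Mapping.lookup v i then 1 else 0)" for i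
  have f: "Poly_Mapping.lookup (Abs_poly_mapping g) = g" for g :: "'n \<Rightarrow> nat"
    by simp
  have "Abs_poly_mapping f \<in> power_exps \<S> 1"
    unfolding power_exps_def mem_Collect_eq f
  proof
    fix X assume "X \<in> \<S>"
    then obtain i where "i \<in> X" "?q \<le> Poly_Mapping.lookup v i"
      using v unfolding power_exps_def by blast
    then show "\<exists>i\<in>X. 1 \<le> f i"
      by (intro bexI[of _ i]) (simp_all add: f_def)
  qed
  moreover have "Abs_poly_mapping (\<lambda>i. ?q * f i) \<preceq> v"
    unfolding f by (simp add: f_def)
  ultimately show "\<exists>u\<in>power_exps \<S> 1. \<exists>w. w \<preceq> v \<and>
      Poly_Mapping.lookup w = (\<lambda>i. ?q * Poly_Mapping.lookup u i)"
    by (intro bexI[of _ "Abs_poly_mapping f"] exI[of _ "Abs_poly_mapping (\<lambda>i. ?q * f i)"])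
       (simp_all only: f simp_thms)
qed


section \<open>Products of colon ideals and $L_e$\<close>

lemma sum_subset_ideal:
  assumes "is_ideal T" "\<And>x. x \<in> A \<Longrightarrow> F x \<subseteq> T"
  shows "(\<Sum>x\<in>A. F x) \<subseteq> T"
  using assms(2)
proof (induction A rule: infinite_finite_induct)
  case (insert x A)
  have "(\<Sum>x\<in>A. F x) \<subseteq> T"
    using insert by simp
  moreover have "F x \<subseteq> T"
    using insert by simp
  ultimately have "F x + (\<Sum>x\<in>A. F x) \<subseteq> T"
    using ideal.subspace_add[OF assms(1)] unfolding set_plus_def by blast
  then show ?case
    using insert by simp
qed (use ideal.subspace_0[OF assms(1)] in auto)

lemma is_ideal_ideal_colon:
  assumes "is_ideal A"
  shows "is_ideal (ideal_colon A B)"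
proof (rule ideal.subspaceI)
  show "0 \<in> ideal_colon A B"
    using ideal.subspace_0[OF assms] by (simp add: ideal_colon_def)
  show "x + y \<in> ideal_colon A B" if "x \<in> ideal_colon A B" "y \<in> ideal_colon A B" for x y
    using that ideal.subspace_add[OF assms] by (simp add: ideal_colon_def distrib_right)
  show "c * x \<in> ideal_colon A B" if "x \<in> ideal_colon A B" for c x
    using that ideal.subspace_scale[OF assms] by (simp add: ideal_colon_def mult.assoc del: ideal.scale_scale)
qed

text \<open>One telescoping step: \<open>f\<close> carries \<open>A\<close> into \<open>B\<close>
  and \<open>g\<close> carries \<open>B\<close> into \<open>C\<close>, so \<open>f * g\<close>
  carries \<open>A\<close> into \<open>C\<close>.\<close>

lemma ideal_prod_colon_subset:
  assumes "is_ideal C"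
  shows "ideal_prod (ideal_colon B A) (ideal_colon C B) \<subseteq> ideal_colon C A"
  unfolding ideal_prod_def
proof (rule ideal.span_minimal[OF _ is_ideal_ideal_colon[OF assms]], safe)
  fix f g
  assume fg: "f \<in> ideal_colon B A" "g \<in> ideal_colon C B"
  have "f * g * a \<in> C" if "a \<in> A" for a
  proof -
    have "g * (f * a) \<in> C"
      using fg that unfolding ideal_colon_def by blast
    moreover have "f * g * a = g * (f * a)"
      by (simp only: mult_ac)
    ultimately show ?thesis
      by (simp only:)
  qed
  then show "f * g \<in> ideal_colon C A"
    unfolding ideal_colon_def by blast
qed

lemma ideal_prod_mono: "A \<subseteq> A' \<Longrightarrow> B \<subseteq> B' \<Longrightarrow> ideal_prod A B \<subseteq> ideal_prod A' B'"
  unfolding ideal_prod_def by (rule ideal.span_mono) blast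

lemma ideal_prod_list_colon_subset:
  assumes "\<And>k. is_ideal (F k)" "1 \<le> j" "j \<le> s + 1"
  shows "ideal_prod_list (map (\<lambda>k. ideal_colon (F k) (F (k - 1))) [j..<s + 1]) \<subseteq>
    ideal_colon (F s) (F (j - 1))"
  using assms(3,2)
proof (induction j rule: inc_induct)
  \<comment> \<open>The list is empty and its product is \<open>UNIV\<close>, which agrees with the
    colon of \<open>F s\<close> by itself.\<close>
  case base
  have "f * b \<in> F s" if "b \<in> F s" for f b
    by (rule ideal.subspace_scale[OF assms(1) that])
  then show ?case
    by (auto simp: ideal_prod_list_def ideal_colon_def)
next
  case (step j)
  let ?G = "\<lambda>k. ideal_colon (F k) (F (k - 1))"
  have "ideal_prod_list (map ?G [j..<s + 1]) =
      ideal_prod (?G j) (ideal_prod_list (map ?G [Suc j..<s + 1]))"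
    unfolding ideal_prod_list_def by (subst upt_conv_Cons) (use step.hyps in simp_all)
  also have "\<dots> \<subseteq> ideal_prod (ideal_colon (F j) (F (j - 1))) (ideal_colon (F s) (F j))"
    using step.IH by (intro ideal_prod_mono) auto
  also have "\<dots> \<subseteq> ideal_colon (F s) (F (j - 1))"
    by (rule ideal_prod_colon_subset[OF assms(1)])
  finally show ?case .
qed

lemma is_ideal_frob_power: "is_ideal (frob_power p I a)"
  unfolding frob_power_def by (rule ideal.subspace_span)

text \<open>The factors from index 2 on telescope. The first factor is kept apart: folding it in
  would only give the bound \<open>ideal_colon (frob_power p I e) I\<close>, which contains the
  generators to be excluded.\<close>

lemma L_term_subset:
  assumes "bs \<in> L_indices e"
  shows "L_term p I bs \<subseteq>
    ideal_prod (ideal_colon (frob_power p I (hd bs)) I)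
      (ideal_colon (frob_power p I e) (frob_power p I (hd bs)))"
proof -
  have bs: "bs \<noteq> []" "sum_list bs = e"
    using assms by (auto simp: L_indices_def)
  then have "sum_list (take (2 - 1) bs) = hd bs" "sum_list (take (length bs) bs) = e"
    by (cases bs; simp)+
  moreover have "(1::nat) \<le> 2" "2 \<le> length bs + 1"
    using bs(1) by (simp_all add: Suc_le_eq)
  ultimately show ?thesis
    unfolding L_term_def
    using ideal_prod_list_colon_subset[of "\<lambda>k. frob_power p I (sum_list (take k bs))" 2 "length bs",
        OF is_ideal_frob_power]
    by (intro ideal_prod_mono order_refl) metis
qed


section \<open>Minimal generators avoid products of colon ideals\<close>

text \<open>The combinatorial core, where prime powers enter only through \<open>1 < r < q\<close>.
  Lowering a coordinate of the minimal \<open>v\<close> must violate the colon condition at some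
  member of \<S>, and these members locate the exponents of \<open>v\<close>.\<close>

lemma minimal_colon_exps_not_product:
  fixes v :: "'n::finite \<Rightarrow>\<^sub>0 nat"
  assumes cover: "\<Union>\<S> = UNIV"
    and r: "1 < r" "r < q"
    and v: "v \<in> colon_exps \<S> 1 q"
    and min: "\<And>u. u \<in> colon_exps \<S> 1 q \<Longrightarrow> u \<preceq> v \<Longrightarrow> u = v"
    and small: "\<exists>i. Poly_Mapping.lookup v i < q - 1"
    and w: "w \<in> colon_exps \<S> 1 r" and w': "w' \<in> colon_exps \<S> r q"
  shows "\<not> w + w' \<preceq> v"
proof
  assume le: "w + w' \<preceq> v"
  let ?l = Poly_Mapping.lookup
  have le: "?l w i + ?l w' i \<le> ?l v i" for i
    using le by (simp add: lookup_add)
  define red where "red i c = Abs_poly_mapping ((?l v)(i := c))" for i c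
  have red: "?l (red i c) = (?l v)(i := c)" for i c
    unfolding red_def by simp
  have red_notin: "red i c \<notin> colon_exps \<S> 1 q" if "c < ?l v i" for i c
  proof
    assume "red i c \<in> colon_exps \<S> 1 q"
    then have "red i c = v"
      using that by (intro min) (auto simp: red)
    then have "?l (red i c) i = ?l v i"
      by simp
    then show False
      using that by (simp add: red)
  qed
  have block: "\<exists>X\<in>\<S>. (\<forall>j\<in>X. g j < q) \<and> (\<exists>j\<in>X. g j < q - 1)"
    if g: "\<not> (\<forall>X\<in>\<S>. (\<exists>i\<in>X. q \<le> g i) \<or> (\<forall>i\<in>X. q \<le> g i + 1))" for g :: "'n \<Rightarrow> nat"
  proof -
    obtain X where X: "X \<in> \<S>" "\<not> (\<exists>i\<in>X. q \<le> g i)" "\<not> (\<forall>i\<in>X. q \<le> g i + 1)"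
      using g by blast
    then show ?thesis
      by (intro bexI[of _ X]) (simp_all add: not_le less_diff_conv)
  qed
  have red_block: "\<exists>X\<in>\<S>. (\<forall>j\<in>X. ((?l v)(i := c)) j < q) \<and> (\<exists>j\<in>X. ((?l v)(i := c)) j < q - 1)"
    if "c < ?l v i" for i c
    using red_notin[OF that] unfolding colon_exps_def red mem_Collect_eq by (rule block)
  have v_dest: "\<exists>i\<in>X. q \<le> ?l v i" if "X \<in> \<S>" "i \<in> X" "?l v i < q - 1" for X i
  proof -
    have "(\<exists>i\<in>X. q \<le> ?l v i) \<or> (\<forall>i\<in>X. q \<le> ?l v i + 1)"
      using v that(1) unfolding colon_exps_def by blast
    moreover have "\<not> q \<le> ?l v i + 1"
      using that(3) by linarith
    ultimately show ?thesis
      using that(2) by blast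
  qed
  have middle: "\<exists>X\<in>\<S>. j \<in> X \<and> (\<forall>i\<in>X. ?l v i < q)" if j: "0 < ?l v j" "?l v j < q" for j
  proof -
    obtain X where X: "X \<in> \<S>" "\<forall>i\<in>X. ((?l v)(j := 0)) i < q" "\<exists>i\<in>X. ((?l v)(j := 0)) i < q - 1"
      using red_block[OF j(1)] by blast
    have *: "\<forall>i\<in>X. ?l v i < q"
      using X(2) j(2) by (auto split: if_splits)
    \<comment> \<open>Otherwise lowering \<open>j\<close> changes nothing on \<open>X\<close>, and
      \<open>v\<close> itself would violate the condition at \<open>X\<close>.\<close>
    moreover have "j \<in> X"
      using X(1,3) * v_dest[of X] by (metis fun_upd_other not_le)
    ultimately show ?thesis
      using X(1) by blast
  qed
  have zero: "?l v j = 0" if j: "?l v j < q - 1" for j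
  proof (rule ccontr)
    assume "?l v j \<noteq> 0"
    then have "0 < ?l v j" "?l v j < q"
      using j by linarith+
    then obtain X where "X \<in> \<S>" "j \<in> X" "\<forall>i\<in>X. ?l v i < q"
      using middle[of j] by blast
    then show False
      using v_dest[of X j] j by (meson not_le)
  qed
  have "\<exists>i. q \<le> ?l v i"
    using small cover v_dest by blast
  then obtain i where i: "q \<le> ?l v i"
    by blast
  then have "q - 1 < ?l v i"
    using r by linarith
  \<comment> \<open>Lowering \<open>i\<close> to exactly \<open>q - 1\<close> makes \<open>i\<close>
    the only place of \<open>X\<close> where \<open>v\<close> can reach \<open>q\<close>, and forces
    \<open>z\<close> to differ from \<open>i\<close>.\<close>
  from red_block[OF this] obtain X z where X: "X \<in> \<S>" "\<forall>j\<in>X. ((?l v)(i := q - 1)) j < q"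
    and z: "z \<in> X" "((?l v)(i := q - 1)) z < q - 1"
    by blast
  have only_i: "j = i" if "j \<in> X" "q \<le> ?l v j" for j
    using X(2) that by (metis fun_upd_other not_le)
  have z_small: "?l v z < q - 1"
    using z by (auto split: if_splits)
  then have "?l w z = 0" "?l w' z = 0"
    using zero[of z] le[of z] by auto
  \<comment> \<open>The zero at \<open>z\<close> rules out the second alternative for
    \<open>w'\<close> because \<open>r < q\<close>; the place found can only be
    \<open>i\<close>.\<close>
  have "\<exists>j\<in>X. q \<le> ?l w' j"
  proof -
    have "(\<exists>j\<in>X. q \<le> ?l w' j) \<or> (\<forall>j\<in>X. q \<le> ?l w' j + r)"
      using w' X(1) unfolding colon_exps_def by blast
    then show ?thesis
      using z(1) \<open>?l w' z = 0\<close> r by force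
  qed
  then have "q \<le> ?l w' i"
    using only_i le by (metis add_leD2 order_trans)
  moreover have "?l v i \<le> q"
  proof (rule ccontr)
    assume "\<not> ?l v i \<le> q"
    then obtain Y y where Y: "Y \<in> \<S>" "\<forall>j\<in>Y. ((?l v)(i := q)) j < q"
      "y \<in> Y" "((?l v)(i := q)) y < q - 1"
      using red_block[of q i] by (meson not_le)
    \<comment> \<open>So \<open>Y\<close> does not see the change at \<open>i\<close> and would
      already be violated by \<open>v\<close>.\<close>
    then have "i \<notin> Y"
      by auto
    then show False
      using v_dest[of Y y] Y by (metis fun_upd_other not_le)
  qed
  ultimately have "?l w i = 0"
    using le[of i] by linarith
  \<comment> \<open>Again the zero at \<open>z\<close> excludes the second alternative, now because
    \<open>1 < r\<close>. As \<open>w\<close> vanishes at \<open>i\<close>, the place found is not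
    \<open>i\<close>.\<close>
  have "\<exists>j\<in>X. r \<le> ?l w j"
  proof -
    have "(\<exists>j\<in>X. r \<le> ?l w j) \<or> (\<forall>j\<in>X. r \<le> ?l w j + 1)"
      using w X(1) unfolding colon_exps_def by blast
    then show ?thesis
      using z(1) \<open>?l w z = 0\<close> r by force
  qed
  then obtain j where j: "j \<in> X" "r \<le> ?l w j"
    by blast
  then have "?l v j < q" "0 < ?l v j"
    using only_i[of j] \<open>?l w i = 0\<close> r le[of j] by (auto simp: not_le[symmetric])
  then obtain Y where Y: "Y \<in> \<S>" "j \<in> Y" "\<forall>i\<in>Y. ?l v i < q"
    using middle by blast
  \<comment> \<open>Only the second alternative is left for \<open>w'\<close> on \<open>Y\<close>,
    so \<open>w\<close> and \<open>w'\<close> together reach \<open>q\<close> at \<open>j\<close>,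
    where \<open>v\<close> is below \<open>q\<close>.\<close>
  have "\<not> (\<exists>i\<in>Y. q \<le> ?l w' i)"
    using Y(3) le by (metis add_leD2 not_le order_trans)
  then have "q \<le> ?l w' j + r"
    using w' Y unfolding colon_exps_def by blast
  then show False
    using j(2) le[of j] \<open>?l v j < q\<close> by linarith
qed


section \<open>From ideals of variables to families of variable sets, and the conclusion\<close>

lemma ideal_gen_Var:
  "ideal_gen (Var ` X) = (supp_ideal {v. \<exists>i\<in>X. 1 \<le> Poly_Mapping.lookup v i} :: ('n, 'k::comm_ring_1) mpoly set)"
proof -
  have "Var ` X = (monom_of ` (\<lambda>i. Poly_Mapping.single i 1) ` X :: ('n, 'k) mpoly set)"
    by (simp add: Var_def image_image)
  moreover have "Poly_Mapping.single i 1 \<preceq> v \<longleftrightarrow> 1 \<le> Poly_Mapping.lookup v i" for i and v :: "'n \<Rightarrow>\<^sub>0 nat"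
    by (auto simp: lookup_single when_def)
  ultimately show ?thesis
    by (simp add: ideal_gen_monom_of up_closure_def)
qed

lemma prod_Var_power:
  "(\<Prod>i\<in>UNIV. Var i :: ('n::finite, 'k::comm_ring_1) mpoly) ^ n = monom_of (Abs_poly_mapping (\<lambda>_. n))"
proof -
  have "(\<Prod>i\<in>A. Var i :: ('n, 'k) mpoly) = monom_of (\<Sum>i\<in>A. Poly_Mapping.single i 1)" for A :: "'n set"
    by (induction A rule: infinite_finite_induct) (simp_all add: Var_def monom_of_def mult_single)
  then show ?thesis
    by (simp only:) (rule monom_of_power, simp add: lookup_sum lookup_single when_def)
qed

theorem theorem3p8:
  fixes p t e :: nat
    and I :: "('n::finite, 'k::field) mpoly set"
    and Q :: "nat \<Rightarrow> ('n, 'k) mpoly set"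
  assumes "prime p"
    and "CHAR('k) = p"
    and "squarefree_monomial_ideal I"
    and "minimal_primary_decomposition I t Q"
    and "\<And>k. k \<in> {1..t} \<Longrightarrow> generated_by_variables (Q k)"
    and "(\<Sum>k\<in>{1..t}. Q k) = ideal_gen (range Var)"
    and "e \<ge> 1"
    and "J_ideal p I e \<noteq> {0}"
  shows "\<exists>m \<in> minimal_monomial_generators (J_ideal p I e). m \<notin> L_ideal p I e"
proof -
  have "\<forall>k\<in>{1..t}. \<exists>S. Q k = ideal_gen (Var ` S)"
    using assms(5) by (simp add: generated_by_variables_def)
  then obtain S where S: "\<And>k. k \<in> {1..t} \<Longrightarrow> Q k = ideal_gen (Var ` S k)"
    by metis
  define \<S> where "\<S> = S ` {1..t}"
  have I_Int: "I = (\<Inter>k\<in>{1..t}. Q k)"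
    and irredundant: "\<And>k. k \<in> {1..t} \<Longrightarrow> \<not> (\<Inter>j\<in>{1..t} - {k}. Q j) \<subseteq> Q k"
    using assms(4) by (auto simp: minimal_primary_decomposition_def)
  \<comment> \<open>If \<open>S j\<close> lies in \<open>S k\<close> with distinct indices, then
    \<open>Q k\<close> is redundant in the intersection.\<close>
  have antichain: "X = Y" if XY: "X \<in> \<S>" "Y \<in> \<S>" "X \<subseteq> Y" for X Y
  proof -
    obtain j k where jk: "j \<in> {1..t}" "X = S j" "k \<in> {1..t}" "Y = S k"
      using XY by (auto simp: \<S>_def)
    have "Q j \<subseteq> Q k"
      unfolding S[OF jk(1)] S[OF jk(3)]
      using jk XY(3) by (intro ideal.span_mono image_mono) simp
    then have "j = k"
      using irredundant[of k] jk by blast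
    then show ?thesis
      using jk by simp
  qed
  have I: "I = supp_ideal (power_exps \<S> 1)"
  proof -
    have "I = (\<Inter>k\<in>{1..t}. supp_ideal {v. \<exists>i\<in>S k. 1 \<le> Poly_Mapping.lookup v i})"
      unfolding I_Int by (rule INF_cong) (simp_all add: S ideal_gen_Var)
    then show ?thesis
      by (auto simp: supp_ideal_def power_exps_def \<S>_def subset_eq)
  qed
  have cover: "\<Union>\<S> = UNIV"
  proof (rule ccontr)
    assume "\<Union>\<S> \<noteq> UNIV"
    then obtain i where i: "i \<notin> \<Union>\<S>"
      by blast
    \<comment> \<open>An uncovered variable would be missing from the sum of the components, which
      is the ideal of all variables.\<close>
    have "(\<Sum>k\<in>{1..t}. Q k) \<subseteq> ideal_gen (Var ` (- {i}))"
    proof (rule sum_subset_ideal[OF ideal.subspace_span])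
      fix k assume k: "k \<in> {1..t}"
      then have "S k \<subseteq> - {i}"
        using i by (auto simp: \<S>_def)
      then show "Q k \<subseteq> ideal_gen (Var ` (- {i}))"
        unfolding S[OF k] by (intro ideal.span_mono image_mono)
    qed
    moreover have "Var i \<in> ideal_gen (range Var :: ('n, 'k) mpoly set)"
      by (rule ideal.span_base) simp
    ultimately have "(Var i :: ('n, 'k) mpoly) \<in> ideal_gen (Var ` (- {i}))"
      using assms(6) by auto
    then show False
      unfolding ideal_gen_Var by (auto simp: Var_def lookup_single when_def split: if_splits)
  qed
  have frob: "frob_power p I a = supp_ideal (power_exps \<S> (p ^ a))" for a
    using frob_power_power_exps[where ?'k = 'k, of \<S> a] assms(1,2) by (simp add: I)
  have colon: "ideal_colon (frob_power p I b) (frob_power p I a) =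
      supp_ideal (colon_exps \<S> (p ^ a) (p ^ b))" for a b
    unfolding frob by (rule ideal_colon_power_exps[OF antichain])
  \<comment> \<open>Here \<open>I\<close> is its own Frobenius power with exponent 0, so
    \<open>r\<close> is \<open>p ^ 0 = 1\<close>.\<close>
  have colon_I: "ideal_colon (frob_power p I b) I = supp_ideal (colon_exps \<S> 1 (p ^ b))" for b
    using colon[of b 0] frob[of 0] I by simp
  \<comment> \<open>The exponents of a monomial ideal that contains
    \<open>L_ideal p I e\<close>.\<close>
  define D where "D = up_closure {w + w' | w w' a. 1 \<le> a \<and> a < e \<and>
    w \<in> colon_exps \<S> 1 (p ^ a) \<and> w' \<in> colon_exps \<S> (p ^ a) (p ^ e)}"
  have D_ideal: "is_ideal (supp_ideal D :: ('n, 'k) mpoly set)"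
    unfolding D_def ideal_gen_monom_of[symmetric] by (rule ideal.subspace_span)
  have L_D: "L_ideal p I e \<subseteq> supp_ideal D"
    unfolding L_ideal_def
  proof (rule sum_subset_ideal[OF D_ideal])
    fix bs assume bs: "bs \<in> L_indices e"
    define a where "a = hd bs"
    have a: "1 \<le> a" "a < e"
      using bs assms(7) by (cases bs; force simp: L_indices_def a_def)+
    have "L_term p I bs \<subseteq> ideal_prod (supp_ideal (colon_exps \<S> 1 (p ^ a)))
        (supp_ideal (colon_exps \<S> (p ^ a) (p ^ e)))"
      using L_term_subset[OF bs, of p I] by (simp only: colon colon_I a_def)
    also have "\<dots> \<subseteq> supp_ideal D"
      unfolding ideal_prod_def
    proof (rule ideal.span_minimal[OF _ D_ideal], safe)
      fix f g :: "('n, 'k) mpoly"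
      assume fg: "f \<in> supp_ideal (colon_exps \<S> 1 (p ^ a))" "g \<in> supp_ideal (colon_exps \<S> (p ^ a) (p ^ e))"
      have "x \<in> D" if "x \<in> Poly_Mapping.keys (f * g)" for x
      proof -
        have "x \<in> {w + w' | w w' a. 1 \<le> a \<and> a < e \<and>
            w \<in> colon_exps \<S> 1 (p ^ a) \<and> w' \<in> colon_exps \<S> (p ^ a) (p ^ e)}"
          using keys_mult[of f g] fg that a unfolding supp_ideal_def by blast
        then show ?thesis
          unfolding D_def by (rule subsetD[OF subset_up_closure])
      qed
      then show "f * g \<in> supp_ideal D"
        unfolding supp_ideal_def by blast
    qed
    finally show "L_term p I bs \<subseteq> supp_ideal D" .
  qed
  define G where "G = {m \<in> minimal_monomial_generators (ideal_colon (frob_power p I e) I).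
    m \<notin> frob_power p I e + ideal_gen {(\<Prod>i\<in>UNIV. Var i) ^ (p ^ e - 1)}}"
  have J: "J_ideal p I e = ideal_gen G"
    by (simp add: J_ideal_def G_def)
  have G_min: "\<exists>v. m = monom_of v \<and> v \<in> colon_exps \<S> 1 (p ^ e) \<and>
      (\<forall>u\<in>colon_exps \<S> 1 (p ^ e). u \<preceq> v \<longrightarrow> u = v)" if m: "m \<in> G" for m
  proof -
    have "m \<in> minimal_monomial_generators (supp_ideal (colon_exps \<S> 1 (p ^ e)))"
      using m unfolding G_def colon_I by blast
    then show ?thesis
      by (rule minimal_monomial_generatorsE) blast
  qed
  \<comment> \<open>Divisibility-minimality in the whole colon ideal is recorded, which makes
    \<open>E\<close> an antichain and supplies the hypothesis \<open>min\<close> of the core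
    lemma.\<close>
  define E where "E = {v \<in> colon_exps \<S> 1 (p ^ e). monom_of v \<in> G \<and>
      (\<forall>u\<in>colon_exps \<S> 1 (p ^ e). u \<preceq> v \<longrightarrow> u = v)}"
  have G_E: "G = monom_of ` E"
  proof
    show "G \<subseteq> monom_of ` E"
    proof
      fix m assume "m \<in> G"
      then show "m \<in> monom_of ` E"
        using G_min[of m] unfolding E_def by blast
    qed
  qed (auto simp: E_def)
  then have G_gens: "G \<subseteq> minimal_monomial_generators (ideal_gen G)"
    by (rule minimal_monomial_generatorsI) (unfold E_def, blast)
  have "G \<noteq> {}"
    using assms(8) unfolding J by (metis ideal.span_empty)
  then obtain v where v: "v \<in> E" "monom_of v \<in> G"
    using G_E by auto
  \<comment> \<open>If all exponents were at least \<open>p ^ e - 1\<close>, the monomial would lie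
    in the ideal excluded in the definition of \<open>J_ideal\<close>.\<close>
  have small: "\<exists>i. Poly_Mapping.lookup v i < p ^ e - 1"
  proof (rule ccontr)
    assume "\<not> ?thesis"
    then have "Abs_poly_mapping (\<lambda>_. p ^ e - 1) \<preceq> v"
      by (simp add: not_less)
    then have "monom_of v \<in> ideal_gen (monom_of ` {Abs_poly_mapping (\<lambda>_. p ^ e - 1)} :: ('n, 'k) mpoly set)"
      unfolding ideal_gen_monom_of by (simp add: up_closure_def)
    then have "0 + monom_of v \<in> frob_power p I e + ideal_gen {(\<Prod>i\<in>UNIV. Var i) ^ (p ^ e - 1)}"
      using ideal.subspace_0[OF is_ideal_frob_power[of p I e]]
      by (intro set_plus_intro) (simp_all add: prod_Var_power)
    then show False
      using v(2) by (simp add: G_def)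
  qed
  have "v \<notin> D"
  proof
    assume "v \<in> D"
    then obtain w w' a where D: "1 \<le> a" "a < e" "w \<in> colon_exps \<S> 1 (p ^ a)"
      "w' \<in> colon_exps \<S> (p ^ a) (p ^ e)" "w + w' \<preceq> v"
      unfolding D_def up_closure_def by blast
    have "1 < p"
      using assms(1) by (rule prime_gt_1_nat)
    then have "1 < p ^ a" "p ^ a < p ^ e"
      using D(1,2) one_less_power[of p a] by simp_all
    then show False
      using minimal_colon_exps_not_product[OF cover _ _ _ _ small D(3,4)] D(5) v(1)
      unfolding E_def by blast
  qed
  then have "monom_of v \<notin> L_ideal p I e"
    using L_D monom_of_in_supp_ideal by blast
  then show ?thesis
    unfolding J using G_gens v(2) by blast
qed

end
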